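(* Let $A$ be a unital $C^*$-algebra with unit $I$, let $H$ be a Hilbert $A$-module, and suppose that the finite family $\{e_n\}_{n=0}^{k}\subseteq H$ algebraically generates $H$ and satisfies $\langle e_n,e_n\rangle = I$ for all $0\le n\le k$. Let $\{e_n\}_{n=0}^{\infty}$ be the $(k+1)$-periodic extension of $\{e_n\}_{n=0}^{k}$, i.e. $e_{n+k+1}=e_n$ for all $n\ge 0$. Then $\{e_n\}_{n=0}^{\infty}$ is effective.
   Context: A Hilbert $A$-module ($A$ a unital $C^*$-algebra) is a complex vector space and left $A$-module $H$ with an inner product $\langle\cdot,\cdot\rangle:H\times H\to A$ such that $\langle x,x\rangle\ge 0$ with equality iff $x=0$, $\langle x,y\rangle=\langle y,x\rangle^*$, and $\langle ax+by,z\rangle=a\langle x,z\rangle+b\langle y,z\rangle$ for $a,b\in A$, and which is complete in the norm $\|x\|=\sqrt{\|\langle x,x\rangle\|_A}$. A finite family $\{e_n\}_{n=0}^k$ algebraically generates $H$ if every element of $H$ has the form $\sum_{n=0}^k c_ne_n$ with $c_n\in A$. A sequence $\{e_n\}_{n=0}^\infty\subseteq H$ with $\langle e_n,e_n\rangle=I$ for all $n$ is called effective if for every $x\in H$ the sequence defined by $x_0=\langle x,e_0\rangle e_0$ and $x_n=x_{n-1}+\langle x-x_{n-1},e_n\rangle e_n$ for $n\ge1$ converges to $x$ in norm. *)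

theory Defs
  imports "HOL-Analysis.Analysis"
begin

text \<open>
  The sort does not contain \<^class>\<open>ring_1\<close>, so the zero algebra is not excluded.
  The library has no complex normed algebras: completeness and the (submultiplicative) norm come
  from the real classes, and the complex scalar multiplication \<open>cs\<close> extends the real one.
\<close>

locale unital_cstar_algebra =
  vector_space cs
  for cs :: "complex \<Rightarrow> 'a \<Rightarrow> 'a::{real_normed_algebra, monoid_mult, banach}" +
  fixes star :: "'a \<Rightarrow> 'a"
  assumes cs_of_real: "cs (complex_of_real r) a = r *\<^sub>R a"
    and norm_cs: "norm (cs z a) = cmod z * norm a"
    and cs_mult_left: "cs z a * b = cs z (a * b)"
    and cs_mult_right: "a * cs z b = cs z (a * b)"
    and star_star: "star (star a) = a"
    and star_add: "star (a + b) = star a + star b"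
    and star_cs: "star (cs z a) = cs (cnj z) (star a)"
    and star_mult: "star (a * b) = star b * star a"
    and cstar_identity: "norm (star a * a) = (norm a)\<^sup>2"

definition alg_spectrum :: "(complex \<Rightarrow> 'a \<Rightarrow> 'a) \<Rightarrow> 'a::{ring, monoid_mult} \<Rightarrow> complex set" where
  "alg_spectrum cs a = {z. \<not> (\<exists>b. (a - cs z 1) * b = 1 \<and> b * (a - cs z 1) = 1)}"

definition cstar_positive ::
    "(complex \<Rightarrow> 'a \<Rightarrow> 'a) \<Rightarrow> ('a \<Rightarrow> 'a) \<Rightarrow> 'a::{ring, monoid_mult} \<Rightarrow> bool" where
  "cstar_positive cs star a \<longleftrightarrow>
     star a = a \<and> alg_spectrum cs a \<subseteq> complex_of_real ` {0..}"

definition module_norm :: "('h \<Rightarrow> 'h \<Rightarrow> 'a::real_normed_vector) \<Rightarrow> 'h \<Rightarrow> real" where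
  "module_norm ip x = sqrt (norm (ip x x))"

text \<open>
  \<open>act\<close> is the left action of the algebra and \<open>hs\<close> the complex scalar multiplication of the
  module. The inner product is linear in the first argument. No relation between \<open>hs\<close> and \<open>act\<close>
  is imposed, so the usual situation, where \<open>hs z x = act (cs z 1) x\<close>, is included.
\<close>

locale hilbert_module =
  unital_cstar_algebra cs star + hs: vector_space hs
  for cs :: "complex \<Rightarrow> 'a \<Rightarrow> 'a::{real_normed_algebra, monoid_mult, banach}"
    and star :: "'a \<Rightarrow> 'a"
    and hs :: "complex \<Rightarrow> 'h \<Rightarrow> 'h::ab_group_add" +
  fixes act :: "'a \<Rightarrow> 'h \<Rightarrow> 'h"
    and ip :: "'h \<Rightarrow> 'h \<Rightarrow> 'a"
  assumes act_add_left: "act (a + b) x = act a x + act b x"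
    and act_add_right: "act a (x + y) = act a x + act a y"
    and act_mult: "act (a * b) x = act a (act b x)"
    and act_one: "act 1 x = x"
    and ip_positive: "cstar_positive cs star (ip x x)"
    and ip_eq_0_iff: "ip x x = 0 \<longleftrightarrow> x = 0"
    and ip_commute: "ip x y = star (ip y x)"
    and ip_linear: "ip (act a x + act b y) z = a * ip x z + b * ip y z"
    and complete: "Metric_space.mcomplete UNIV (\<lambda>x y. module_norm ip (x - y))"

definition alg_generates ::
    "('a \<Rightarrow> 'h \<Rightarrow> 'h::comm_monoid_add) \<Rightarrow> (nat \<Rightarrow> 'h) \<Rightarrow> nat \<Rightarrow> bool" where
  "alg_generates act e k \<longleftrightarrow> (\<forall>x. \<exists>c. x = (\<Sum>n\<le>k. act (c n) (e n)))"

primrec kaczmarz ::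
    "('a \<Rightarrow> 'h \<Rightarrow> 'h::ab_group_add) \<Rightarrow> ('h \<Rightarrow> 'h \<Rightarrow> 'a) \<Rightarrow> (nat \<Rightarrow> 'h) \<Rightarrow> 'h \<Rightarrow> nat \<Rightarrow> 'h" where
  "kaczmarz act ip e x 0 = act (ip x (e 0)) (e 0)"
| "kaczmarz act ip e x (Suc n) = kaczmarz act ip e x n
     + act (ip (x - kaczmarz act ip e x n) (e (Suc n))) (e (Suc n))"

definition effective ::
    "('a \<Rightarrow> 'h \<Rightarrow> 'h::ab_group_add) \<Rightarrow> ('h \<Rightarrow> 'h \<Rightarrow> 'a::{real_normed_algebra, monoid_mult})
      \<Rightarrow> (nat \<Rightarrow> 'h) \<Rightarrow> bool" where
  "effective act ip e \<longleftrightarrow>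
     (\<forall>n. ip (e n) (e n) = 1) \<and>
     (\<forall>x. (\<lambda>n. module_norm ip (kaczmarz act ip e x n - x)) \<longlonglongrightarrow> 0)"

end

theory Submission
  imports Defs
begin

text \<open>
  Each step of the iteration removes from the residual its component along a unit vector, so
  by Pythagoras the square \<open>\<langle>r,r\<rangle>\<close> of the residual decreases in the order of the algebra. It suffices
  that a full period, in which every generator is used once, shrinks the norm of \<open>\<langle>r,r\<rangle>\<close> by a
  factor below one that does not depend on \<open>r\<close>.

  Two facts give this factor. First, the generators satisfy a lower frame bound: the norm of a
  vector \<open>y\<close> is at most a constant times the sum of the norms of the \<open>\<langle>y,e\<^sub>n\<rangle>\<close>
  (\<open>frame_lower_bound\<close>, by Baire's theorem). Secondly, if a period hardly changed the norm of
  \<open>\<langle>r,r\<rangle>\<close>, the removed coefficients would be small, in the order of the algebra, wherever the new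
  square is nearly as large as its norm; the inner products of the new residual with all generators
  would be small there too, contradicting the frame bound (\<open>sweep_contraction\<close>). A state
  attaining the norm would make "there" precise; here a resolvent plays its part, which avoids
  the Hahn-Banach theorem.

  The argument needs the order of a C*-algebra: the norm is monotone on nonnegative elements, sums
  of nonnegative elements are nonnegative, and the norm of a nonnegative element is in its
  spectrum. All of this follows from square roots given by the binomial series
  (\<open>selfadjoint_sqrt\<close>) by way of \<open>norm_attained_in_spectrum\<close>.
\<close>

section \<open>The binomial series in a Banach algebra\<close>

text \<open>
  The power series of \<open>(1 - h)\<^sup>g\<close>. The exponents \<open>-1\<close> and \<open>1/2\<close> give the Neumann
  inverse and the square root of \<open>1 - h\<close>.
\<close>
definition binomial_power :: "real \<Rightarrow> 'a \<Rightarrow> 'a::{real_normed_algebra, monoid_mult, banach}" where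
  "binomial_power g h = (\<Sum>n. ((-1) ^ n * (g gchoose n)) *\<^sub>R h ^ n)"

text \<open>
  The norm of \<open>1\<close> has to appear: in the class at hand it need not equal one.
\<close>
lemma norm_power_le:
  fixes h :: "'a::{real_normed_algebra, monoid_mult}"
  shows "norm (h ^ n) \<le> norm (1 :: 'a) * norm h ^ n"
proof (induction n)
  case (Suc n)
  have "norm (h ^ Suc n) \<le> norm (h ^ n) * norm h"
    by (simp only: power_Suc2 norm_mult_ineq)
  also have "\<dots> \<le> norm (1 :: 'a) * norm h ^ n * norm h"
    using Suc by (intro mult_right_mono) auto
  finally show ?case by (simp add: mult_ac)
qed simp

lemma abs_gbinomial_le_1:
  fixes g :: real
  assumes "\<bar>g\<bar> \<le> 1"
  shows "\<bar>g gchoose n\<bar> \<le> 1"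
proof (induction n)
  case (Suc n)
  have "g gchoose Suc n = (g gchoose n) * ((g - real n) / real (Suc n))"
    using gbinomial_mult_1[of g n] by (simp add: field_simps)
  moreover have "\<bar>(g - real n) / real (Suc n)\<bar> \<le> 1"
    using assms by (simp add: abs_le_iff field_simps)
  ultimately show ?case
    using Suc by (metis abs_ge_zero abs_mult mult_le_one)
qed simp

lemma summable_norm_binomial_series:
  fixes h :: "'a::{real_normed_algebra, monoid_mult, banach}"
  assumes "\<bar>g\<bar> \<le> 1" "norm h < 1"
  shows "summable (\<lambda>n. norm (((-1) ^ n * (g gchoose n)) *\<^sub>R h ^ n))"
proof (rule summable_comparison_test)
  show "summable (\<lambda>n. norm (1 :: 'a) * norm h ^ n)"
    using assms(2) by (intro summable_mult summable_geometric) auto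
  have "\<bar>g gchoose n\<bar> * norm (h ^ n) \<le> 1 * (norm (1 :: 'a) * norm h ^ n)" for n
    using abs_gbinomial_le_1[OF assms(1)] norm_power_le[of h n] by (intro mult_mono) auto
  then show "\<exists>N. \<forall>n\<ge>N. norm (norm (((-1) ^ n * (g gchoose n)) *\<^sub>R h ^ n))
      \<le> norm (1 :: 'a) * norm h ^ n"
    by (simp add: abs_mult power_abs)
qed

text \<open>
  The Cauchy product of the two series has the coefficients of the series for \<open>g + d\<close>; this
  is Vandermonde's identity. The restriction to exponents of modulus at most one keeps all
  coefficients bounded by one, so that a geometric series dominates.
\<close>
lemma binomial_power_add:
  fixes h :: "'a::{real_normed_algebra, monoid_mult, banach}"
  assumes "\<bar>g\<bar> \<le> 1" "\<bar>d\<bar> \<le> 1" "norm h < 1"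
  shows "binomial_power g h * binomial_power d h = binomial_power (g + d) h"
proof -
  let ?c = "\<lambda>g n. ((-1) ^ n * (g gchoose n)) :: real"
  have "binomial_power g h * binomial_power d h
      = (\<Sum>n. \<Sum>i\<le>n. (?c g i *\<^sub>R h ^ i) * (?c d (n - i) *\<^sub>R h ^ (n - i)))"
    unfolding binomial_power_def
    by (rule Cauchy_product) (rule summable_norm_binomial_series[OF _ assms(3)], fact)+
  also have "(\<lambda>n. \<Sum>i\<le>n. (?c g i *\<^sub>R h ^ i) * (?c d (n - i) *\<^sub>R h ^ (n - i)))
      = (\<lambda>n. ?c (g + d) n *\<^sub>R h ^ n)"
  proof
    fix n
    have "(\<Sum>i\<le>n. (?c g i *\<^sub>R h ^ i) * (?c d (n - i) *\<^sub>R h ^ (n - i)))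
        = (\<Sum>i\<le>n. ((-1) ^ n * ((g gchoose i) * (d gchoose (n - i)))) *\<^sub>R h ^ n)"
    proof (rule sum.cong)
      fix i assume "i \<in> {..n}"
      then have i: "i \<le> n" by simp
      have *: "x ^ i * x ^ (n - i) = x ^ n" for x :: "'b::monoid_mult"
        using i by (simp flip: power_add)
      have "(?c g i *\<^sub>R h ^ i) * (?c d (n - i) *\<^sub>R h ^ (n - i))
          = (?c g i * ?c d (n - i)) *\<^sub>R h ^ n"
        by (simp add: *)
      also have "?c g i * ?c d (n - i) = ((-1) ^ i * (-1) ^ (n - i)) * ((g gchoose i) * (d gchoose (n - i)))"
        by (simp add: mult_ac)
      finally show "(?c g i *\<^sub>R h ^ i) * (?c d (n - i) *\<^sub>R h ^ (n - i))
          = ((-1) ^ n * ((g gchoose i) * (d gchoose (n - i)))) *\<^sub>R h ^ n"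
        by (simp only: *)
    qed simp
    also have "\<dots> = ?c (g + d) n *\<^sub>R h ^ n"
      using gbinomial_Vandermonde[of g d n]
      by (simp add: atLeast0AtMost flip: scaleR_sum_left sum_distrib_left)
    finally show "(\<Sum>i\<le>n. (?c g i *\<^sub>R h ^ i) * (?c d (n - i) *\<^sub>R h ^ (n - i)))
        = ?c (g + d) n *\<^sub>R h ^ n" .
  qed
  finally show ?thesis by (simp add: binomial_power_def)
qed

lemma binomial_power_0: "binomial_power 0 h = 1"
proof -
  have "binomial_power 0 h = (\<Sum>n\<in>{0}. ((-1) ^ n * (0 gchoose n)) *\<^sub>R h ^ n)"
    unfolding binomial_power_def by (rule suminf_finite) (auto simp: gbinomial_0_left)
  then show ?thesis by simp
qed

lemma binomial_power_1: "binomial_power 1 h = 1 - h"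
proof -
  have "(1 :: real) gchoose n = 0" if "n \<notin> {0, 1}" for n
    using that binomial_gbinomial[of 1 n, where 'a = real] by (simp add: binomial_eq_0)
  then have "binomial_power 1 h = (\<Sum>n\<in>{0, 1}. ((-1) ^ n * (1 gchoose n)) *\<^sub>R h ^ n)"
    unfolding binomial_power_def by (intro suminf_finite) auto
  then show ?thesis by simp
qed

lemma binomial_power_commute:
  fixes h :: "'a::{real_normed_algebra, monoid_mult, banach}"
  assumes "\<bar>g\<bar> \<le> 1" "norm h < 1" and yh: "y * h = h * y"
  shows "y * binomial_power g h = binomial_power g h * y"
proof -
  have p: "y * h ^ n = h ^ n * y" for n
  proof (induction n)
    case (Suc n)
    then show ?case by (metis yh mult.assoc power_Suc)
  qed simp
  have s: "summable (\<lambda>n. ((-1) ^ n * (g gchoose n)) *\<^sub>R h ^ n)"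
    by (rule summable_norm_cancel[OF summable_norm_binomial_series[OF assms(1,2)]])
  show ?thesis
    unfolding binomial_power_def suminf_mult[OF s, symmetric] suminf_mult2[OF s]
    by (intro suminf_cong) (simp only: mult_scaleR_left mult_scaleR_right p)
qed

section \<open>Self-adjoint and nonnegative elements of a unital C*-algebra\<close>
definition invertible_elt :: "'a::monoid_mult \<Rightarrow> bool" where
  "invertible_elt a \<longleftrightarrow> (\<exists>b. a * b = 1 \<and> b * a = 1)"

lemma invertible_elt_mult:
  assumes "invertible_elt a" "invertible_elt b"
  shows "invertible_elt (a * b)"
proof -
  obtain a' b' where i: "a * a' = 1" "a' * a = 1" "b * b' = 1" "b' * b = 1"
    using assms unfolding invertible_elt_def by auto
  have "(a * b) * (b' * a') = a * (b * b') * a'" "(b' * a') * (a * b) = b' * (a' * a) * b"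
    by (simp_all only: mult.assoc)
  then show ?thesis unfolding invertible_elt_def using i by (intro exI[of _ "b' * a'"]) simp
qed

lemma invertible_elt_scaleR:
  fixes a :: "'a::{real_normed_algebra, monoid_mult}"
  assumes "invertible_elt a" "r \<noteq> 0"
  shows "invertible_elt (r *\<^sub>R a)"
proof -
  obtain b where "a * b = 1" "b * a = 1" using assms unfolding invertible_elt_def by auto
  then show ?thesis
    using assms unfolding invertible_elt_def by (intro exI[of _ "inverse r *\<^sub>R b"]) simp
qed

lemma invertible_one_minus:
  fixes h :: "'a::{real_normed_algebra, monoid_mult, banach}"
  assumes "norm h < 1"
  shows "invertible_elt (1 - h)"
  using binomial_power_add[of 1 "-1" h] binomial_power_add[of "-1" 1 h] assms
  unfolding invertible_elt_def by (auto simp: binomial_power_0 binomial_power_1)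

lemma invertible_scalar_minus:
  fixes h :: "'a::{real_normed_algebra, monoid_mult, banach}"
  assumes "norm h < r"
  shows "invertible_elt (r *\<^sub>R 1 - h)"
proof -
  have r: "r > 0" using assms norm_ge_zero[of h] by linarith
  then have "invertible_elt (1 - inverse r *\<^sub>R h)"
    using assms by (intro invertible_one_minus) (simp add: field_simps)
  then have "invertible_elt (r *\<^sub>R (1 - inverse r *\<^sub>R h))"
    using r by (intro invertible_elt_scaleR) auto
  then show ?thesis using r by (simp add: scaleR_diff_right)
qed

context unital_cstar_algebra
begin

lemma star_scaleR: "star (r *\<^sub>R a) = r *\<^sub>R star a"
  using star_cs[of "complex_of_real r" a] by (simp add: cs_of_real)

lemma star_zero [simp]: "star 0 = 0"
  using star_scaleR[of 0 0] by simp

lemma star_minus: "star (- a) = - star a"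
  using star_scaleR[of "-1" a] by simp

lemma star_diff: "star (a - b) = star a - star b"
  using star_add[of a "- b"] by (simp add: star_minus)

lemma star_one [simp]: "star 1 = 1"
  using star_mult[of "star 1" 1] by (simp add: star_star)

lemma norm_star: "norm (star a) = norm a"
proof -
  have "norm b \<le> norm (star b)" for b
  proof (cases "b = 0")
    case False
    have "(norm b)\<^sup>2 \<le> norm (star b) * norm b"
      using norm_mult_ineq[of "star b" b] by (simp add: cstar_identity)
    then show ?thesis using False by (simp add: power2_eq_square)
  qed simp
  from this[of a] this[of "star a"] show ?thesis by (simp add: star_star)
qed

lemma norm_mult_star: "norm (a * star a) = (norm a)\<^sup>2"
  using cstar_identity[of "star a"] by (simp add: star_star norm_star)

lemma norm_square_selfadjoint: "star a = a \<Longrightarrow> norm (a * a) = (norm a)\<^sup>2"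
  using cstar_identity[of a] by simp

lemma norm_one_le: "norm (1::'a) \<le> 1"
  using cstar_identity[of 1] by (auto simp: power2_eq_square)

lemma norm_scalar_le: "norm (r *\<^sub>R (1::'a)) \<le> \<bar>r\<bar>"
  using norm_one_le by (simp add: mult_left_le)

lemma bounded_linear_star: "bounded_linear star"
  by (rule bounded_linear_intro[of _ 1]) (simp_all add: star_add star_scaleR norm_star)

lemma star_binomial_power:
  assumes "\<bar>g\<bar> \<le> 1" "norm h < 1" "star h = h"
  shows "star (binomial_power g h) = binomial_power g h"
proof -
  have p: "star (h ^ n) = h ^ n" for n
  proof (induction n)
    case (Suc n)
    then show ?case by (metis star_mult assms(3) power_Suc power_Suc2)
  qed simp
  have s: "summable (\<lambda>n. ((-1) ^ n * (g gchoose n)) *\<^sub>R h ^ n)"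
    by (rule summable_norm_cancel[OF summable_norm_binomial_series[OF assms(1,2)]])
  show ?thesis
    unfolding binomial_power_def bounded_linear.suminf[OF bounded_linear_star s]
    by (intro suminf_cong) (simp only: star_scaleR p)
qed

lemma selfadjoint_sqrt:
  assumes "star h = h" "norm h < r"
  obtains s where "star s = s" "s * s = r *\<^sub>R 1 - h" "\<And>y. y * h = h * y \<Longrightarrow> y * s = s * y"
proof
  have r: "r > 0" using assms norm_ge_zero[of h] by linarith
  let ?h = "inverse r *\<^sub>R h"
  let ?s = "sqrt r *\<^sub>R binomial_power (1/2) ?h"
  have h: "norm ?h < 1" "star ?h = ?h" using r assms by (simp_all add: field_simps star_scaleR)
  show "star ?s = ?s" using h by (simp add: star_scaleR star_binomial_power)
  show "?s * ?s = r *\<^sub>R 1 - h"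
  proof -
    have "?s * ?s = r *\<^sub>R (1 - ?h)"
      using r h binomial_power_add[of "1/2" "1/2" ?h] by (simp add: binomial_power_1)
    then show ?thesis using r by (simp add: scaleR_diff_right)
  qed
  show "y * ?s = ?s * y" if "y * h = h * y" for y
    using binomial_power_commute[of "1/2" ?h y] h that by simp
qed

text \<open>
  For commuting self-adjoint \<open>x\<close> and \<open>y\<close> the element \<open>z = x + \<i>y\<close> is normal with
  \<open>z\<^sup>*z = x\<^sup>2 + y\<^sup>2\<close>, and \<open>x\<close> is its real part, so the norm of \<open>x\<close> is at most that of \<open>z\<close>. This
  instance of monotonicity of the norm comes before any theory of positive elements and is what
  that theory is built from.
\<close>
lemma norm_square_le_sum_squares:
  assumes x: "star x = x" and y: "star y = y" and c: "x * y = y * x"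
  shows "norm (x * x) \<le> norm (x * x + y * y)"
proof -
  let ?z = "x + cs \<i> y"
  have sz: "star ?z = x - cs \<i> y"
    by (simp add: star_add star_cs x y)
  have ii: "cs \<i> (cs \<i> w) = - w" for w
    using cs_of_real[of "-1" w] by simp
  have "star ?z * ?z = x * x + y * y"
    unfolding sz by (simp add: algebra_simps cs_mult_left cs_mult_right ii c)
  then have z: "norm (x * x + y * y) = (norm ?z)\<^sup>2"
    by (metis cstar_identity)
  have "2 *\<^sub>R x = ?z + star ?z" unfolding sz by (simp add: scaleR_2)
  then have "norm (2 *\<^sub>R x) \<le> norm ?z + norm (star ?z)" by (metis norm_triangle_ineq)
  then have "norm x \<le> norm ?z" by (simp add: norm_star)
  then show ?thesis by (simp add: z norm_square_selfadjoint[OF x])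
qed

lemma star_inverse:
  assumes "star a = a" "a * b = 1" "b * a = 1"
  shows "star b = b"
proof -
  have "star b * a = 1" using star_mult[of a b] assms by simp
  then have "star b * (a * b) = b" by (simp flip: mult.assoc)
  then show ?thesis using assms by simp
qed

text \<open>
  The spectral radius of a self-adjoint element is its norm. Complex function theory and the
  spectral radius formula are avoided as follows. Let \<open>\<rho>\<close> be the norm of \<open>a\<close> and suppose that
  \<open>v = \<rho>\<^sup>2 - a\<^sup>2\<close> has an inverse \<open>w\<close>. For a real \<open>W\<close> beyond the norm of \<open>w\<close> write
  \<open>W - w = r\<^sup>2\<close>; then \<open>v r\<^sup>2 = W v - 1\<close>, that is, \<open>W a\<^sup>2 + v r\<^sup>2 = W \<rho>\<^sup>2 - 1\<close>. If \<open>v\<close> were the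
  square of a \<open>t\<close> commuting with \<open>a\<close> and \<open>r\<close>, the left side would be a sum of commuting squares,
  so the norm \<open>W \<rho>\<^sup>2\<close> of \<open>W a\<^sup>2\<close> would be at most \<open>W \<rho>\<^sup>2 - 1\<close>. The square root exists only
  after adding some \<open>\<epsilon> > 0\<close> to \<open>v\<close>, and \<open>\<epsilon>\<close> is then made small.
\<close>
lemma norm_attained_in_spectrum:
  assumes a: "star a = a" "a \<noteq> 0"
  shows "\<not> (invertible_elt (norm a *\<^sub>R 1 - a) \<and> invertible_elt (norm a *\<^sub>R 1 + a))"
proof
  assume inv: "invertible_elt (norm a *\<^sub>R 1 - a) \<and> invertible_elt (norm a *\<^sub>R 1 + a)"
  define \<rho> where "\<rho> = norm a"
  have \<rho>: "\<rho> > 0" using a by (simp add: \<rho>_def)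
  define v where "v = \<rho>\<^sup>2 *\<^sub>R 1 - a * a"
  have "v = (\<rho> *\<^sub>R 1 - a) * (\<rho> *\<^sub>R 1 + a)"
    by (simp add: v_def algebra_simps power2_eq_square)
  then have "invertible_elt v" using inv by (simp add: \<rho>_def invertible_elt_mult)
  then obtain w where w: "v * w = 1" "w * v = 1" unfolding invertible_elt_def by auto
  have sv: "star v = v" by (simp add: v_def star_diff star_scaleR star_mult a)
  have sw: "star w = w" using star_inverse[OF sv w] .
  have av: "a * v = v * a" by (simp add: v_def algebra_simps mult.assoc)
  have aw: "a * w = w * a"
  proof -
    have "w * (v * a) * w = w * (a * v) * w" by (simp add: av)
    then show ?thesis using w by (metis mult.assoc mult.left_neutral mult.right_neutral)
  qed
  \<comment> \<open>The second entry makes \<open>W \<rho>\<^sup>2 - 1\<close> nonnegative, so that it is its own absolute value.\<close>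
  define W where "W = max (norm w + 1) (1 / \<rho>\<^sup>2)"
  have W': "norm w < W" "1 / \<rho>\<^sup>2 \<le> W" by (auto simp: W_def)
  have W0: "W > 0" using W'(1) norm_ge_zero[of w] by linarith
  have W: "norm w < W" "W * \<rho>\<^sup>2 \<ge> 1" "W > 0"
    using \<rho> W' W0 by (simp_all add: divide_le_eq)
  obtain r where r: "star r = r" "r * r = W *\<^sub>R 1 - w" "\<And>y. y * w = w * y \<Longrightarrow> y * r = r * y"
    using selfadjoint_sqrt[OF sw W(1)] by blast
  have ar: "a * r = r * a" using r(3) aw by blast
  have key: "W * \<rho>\<^sup>2 \<le> (W * \<rho>\<^sup>2 - 1) + \<epsilon> * norm (r * r)" if \<epsilon>: "\<epsilon> > 0" for \<epsilon>
  proof -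
    have "norm (a * a) < \<rho>\<^sup>2 + \<epsilon>" using \<epsilon> by (simp add: norm_square_selfadjoint a \<rho>_def)
    then obtain t where t: "star t = t" "t * t = (\<rho>\<^sup>2 + \<epsilon>) *\<^sub>R 1 - a * a"
        "\<And>y. y * (a * a) = (a * a) * y \<Longrightarrow> y * t = t * y"
      using selfadjoint_sqrt[of "a * a" "\<rho>\<^sup>2 + \<epsilon>"] a by (metis star_mult)
    have "a * t = t * a" by (rule t(3)) (simp add: mult.assoc)
    have "r * (a * a) = (a * a) * r" by (metis ar mult.assoc)
    then have rt: "r * t = t * r" by (rule t(3))
    have "a * (t * r) = (t * r) * a" by (metis ar \<open>a * t = t * a\<close> mult.assoc)
    moreover have "star (t * r) = t * r" by (simp add: star_mult t r rt)
    ultimately have le: "norm ((sqrt W *\<^sub>R a) * (sqrt W *\<^sub>R a))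
        \<le> norm ((sqrt W *\<^sub>R a) * (sqrt W *\<^sub>R a) + (t * r) * (t * r))"
      using a by (intro norm_square_le_sum_squares) (simp_all add: star_scaleR)
    have lhs: "norm ((sqrt W *\<^sub>R a) * (sqrt W *\<^sub>R a)) = W * \<rho>\<^sup>2"
      using W by (simp add: norm_square_selfadjoint a \<rho>_def)
    have rhs: "(sqrt W *\<^sub>R a) * (sqrt W *\<^sub>R a) + (t * r) * (t * r)
        = (W * \<rho>\<^sup>2 - 1) *\<^sub>R 1 + \<epsilon> *\<^sub>R (r * r)"
    proof -
      have "(t * r) * (t * r) = (t * t) * (r * r)" by (metis rt mult.assoc)
      also have "t * t = v + \<epsilon> *\<^sub>R 1" by (simp add: t v_def algebra_simps)
      also have "(v + \<epsilon> *\<^sub>R 1) * (r * r) = v * (W *\<^sub>R 1 - w) + \<epsilon> *\<^sub>R (r * r)"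
        by (simp add: r(2) distrib_right)
      also have "v * (W *\<^sub>R 1 - w) = W *\<^sub>R v - 1" using w by (simp add: right_diff_distrib)
      finally show ?thesis using W by (simp add: v_def algebra_simps)
    qed
    have "norm ((W * \<rho>\<^sup>2 - 1) *\<^sub>R 1 + \<epsilon> *\<^sub>R (r * r)) \<le> (W * \<rho>\<^sup>2 - 1) + \<epsilon> * norm (r * r)"
      using norm_triangle_ineq[of "(W * \<rho>\<^sup>2 - 1) *\<^sub>R (1::'a)" "\<epsilon> *\<^sub>R (r * r)"]
        norm_scalar_le[of "W * \<rho>\<^sup>2 - 1"] W \<epsilon> by simp
    then show ?thesis using le unfolding lhs rhs by linarith
  qed
  have n: "norm (r * r) + 1 > 0" using norm_ge_zero[of "r * r"] by linarith
  then have "1 / (norm (r * r) + 1) * norm (r * r) < 1" by (simp add: divide_less_eq)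
  then show False using key[of "1 / (norm (r * r) + 1)"] n by (auto simp: zero_less_divide_iff)
qed

text \<open>
  For self-adjoint \<open>a\<close> the inequality says that the spectrum lies in the interval from \<open>0\<close> to
  \<open>2t\<close>. Unlike the definition through the spectrum, this form makes it obvious that sums of
  nonnegative elements are nonnegative.
\<close>
definition nonneg :: "'a \<Rightarrow> bool" where
  "nonneg a \<longleftrightarrow> star a = a \<and> (\<exists>t. norm (t *\<^sub>R 1 - a) \<le> t)"

lemma nonneg_selfadjoint: "nonneg a \<Longrightarrow> star a = a"
  by (simp add: nonneg_def)

lemma nonneg_invertible:
  assumes "nonneg a" "\<mu> > 0"
  shows "invertible_elt (a + \<mu> *\<^sub>R 1)"
proof -
  obtain t where "norm (t *\<^sub>R 1 - a) \<le> t" using assms unfolding nonneg_def by auto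
  then have "invertible_elt ((t + \<mu>) *\<^sub>R 1 - (t *\<^sub>R 1 - a))"
    using assms by (intro invertible_scalar_minus) simp
  then show ?thesis by (simp add: algebra_simps)
qed

text \<open>
  With \<open>t\<close> the norm of \<open>a\<close>, put \<open>c = t - a\<close>. One of the two real numbers of modulus
  \<open>norm c\<close> is in the spectrum of \<open>c\<close>. If it is \<open>norm c\<close>, then \<open>t - norm c\<close> is in the spectrum of
  \<open>a\<close>, hence not negative. If it is \<open>- norm c\<close>, then \<open>t + norm c\<close> is in the spectrum of \<open>a\<close>, hence
  at most \<open>t\<close>.
\<close>
lemma nonnegI_invertible:
  assumes a: "star a = a" and inv: "\<And>\<mu>. \<mu> > 0 \<Longrightarrow> invertible_elt (a + \<mu> *\<^sub>R 1)"
  shows "nonneg a"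
proof -
  define t where "t = norm a"
  define c where "c = t *\<^sub>R 1 - a"
  have "norm c \<le> t"
  proof (rule ccontr)
    assume *: "\<not> norm c \<le> t"
    then have "c \<noteq> 0" by (auto simp: t_def)
    moreover have "star c = c" by (simp add: c_def star_diff star_scaleR a)
    moreover have "invertible_elt (norm c *\<^sub>R 1 - c)"
      using inv[of "norm c - t"] * by (simp add: c_def algebra_simps)
    moreover have "norm a < norm c + t" using \<open>c \<noteq> 0\<close> by (simp add: t_def)
    then have "invertible_elt (norm c *\<^sub>R 1 + c)"
      using invertible_scalar_minus[of a "norm c + t"] by (simp add: c_def algebra_simps)
    ultimately show False using norm_attained_in_spectrum by blast
  qed
  then show ?thesis unfolding nonneg_def c_def using a by blast
qed

lemma nonneg_of_cstar_positive:
  assumes "cstar_positive cs star a"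
  shows "nonneg a"
proof (rule nonnegI_invertible)
  show "star a = a" using assms by (simp add: cstar_positive_def)
  fix \<mu> :: real assume "\<mu> > 0"
  then have "complex_of_real (-\<mu>) \<notin> complex_of_real ` {0..}"
    by (auto simp flip: of_real_minus)
  then have "complex_of_real (-\<mu>) \<notin> alg_spectrum cs a"
    using assms unfolding cstar_positive_def by blast
  then have "invertible_elt (a - cs (complex_of_real (-\<mu>)) 1)"
    unfolding alg_spectrum_def invertible_elt_def by blast
  then show "invertible_elt (a + \<mu> *\<^sub>R 1)"
    by (simp only: cs_of_real) simp
qed

lemma nonneg_add: "nonneg a \<Longrightarrow> nonneg b \<Longrightarrow> nonneg (a + b)"
proof -
  assume ab: "nonneg a" "nonneg b"
  then obtain s t where "norm (s *\<^sub>R 1 - a) \<le> s" "norm (t *\<^sub>R 1 - b) \<le> t"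
    unfolding nonneg_def by auto
  then have "norm ((s + t) *\<^sub>R 1 - (a + b)) \<le> s + t"
    using norm_triangle_ineq[of "s *\<^sub>R 1 - a" "t *\<^sub>R 1 - b"] by (simp add: algebra_simps)
  then show ?thesis using ab unfolding nonneg_def by (auto simp: star_add)
qed

lemma nonneg_zero [simp]: "nonneg 0"
  unfolding nonneg_def by (auto intro!: exI[of _ 0])

lemma nonneg_sum: "(\<And>i. i \<in> I \<Longrightarrow> nonneg (f i)) \<Longrightarrow> nonneg (\<Sum>i\<in>I. f i)"
  by (induction I rule: infinite_finite_induct) (auto intro: nonneg_add)

lemma nonneg_norm_minus:
  assumes "star a = a"
  shows "nonneg (norm a *\<^sub>R 1 - a)"
  unfolding nonneg_def using assms
  by (auto simp: star_diff star_scaleR intro!: exI[of _ "norm a"])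

lemma norm_le_of_bounds:
  assumes a: "star a = a" and "nonneg (s *\<^sub>R 1 - a)" "nonneg (s *\<^sub>R 1 + a)" and s: "s \<ge> 0"
  shows "norm a \<le> s"
proof (rule ccontr)
  assume "\<not> norm a \<le> s"
  then have *: "norm a - s > 0" "a \<noteq> 0" using s by auto
  then have "invertible_elt (norm a *\<^sub>R 1 - a)" "invertible_elt (norm a *\<^sub>R 1 + a)"
    using nonneg_invertible[OF assms(2) *(1)] nonneg_invertible[OF assms(3) *(1)]
    by (simp_all add: algebra_simps)
  then show False using norm_attained_in_spectrum[OF a] * by blast
qed

lemma norm_mono:
  assumes "nonneg a" "nonneg (b - a)"
  shows "norm a \<le> norm b"
proof -
  have "star b = star (a + (b - a))" by simp
  also have "\<dots> = b" using assms by (simp only: star_add nonneg_selfadjoint) simp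
  finally have b: "nonneg (norm b *\<^sub>R 1 - b)" by (rule nonneg_norm_minus)
  show ?thesis
  proof (rule norm_le_of_bounds)
    show "star a = a" using assms by (simp add: nonneg_selfadjoint)
    show "nonneg (norm b *\<^sub>R 1 - a)"
      using nonneg_add[OF b assms(2)] by simp
    have "nonneg (norm b *\<^sub>R 1)"
      using nonneg_norm_minus[of "norm b *\<^sub>R 1"]
      unfolding nonneg_def by (auto simp: star_scaleR intro!: exI[of _ "norm b"])
    then show "nonneg (norm b *\<^sub>R 1 + a)" using assms(1) by (rule nonneg_add)
  qed simp
qed

text \<open>
  The norm of a nonnegative \<open>b\<close> belongs to its spectrum, so the resolvent at \<open>X\<close> is at least the
  reciprocal of the distance from \<open>X\<close> to \<open>norm b\<close>: otherwise a Neumann series would invert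
  \<open>norm b - b\<close>.
\<close>
lemma resolvent_norm_ge:
  assumes b: "nonneg b" "b \<noteq> 0" and p: "(X *\<^sub>R 1 - b) * p = 1" "p * (X *\<^sub>R 1 - b) = 1"
    and X: "norm b \<le> X"
  shows "1 \<le> (X - norm b) * norm p"
proof (rule ccontr)
  assume "\<not> 1 \<le> (X - norm b) * norm p"
  then have "norm ((X - norm b) *\<^sub>R p) < 1" using X by simp
  then have "invertible_elt (1 - (X - norm b) *\<^sub>R p)" by (rule invertible_one_minus)
  moreover have "invertible_elt (X *\<^sub>R 1 - b)" using p unfolding invertible_elt_def by blast
  ultimately have "invertible_elt ((X *\<^sub>R 1 - b) * (1 - (X - norm b) *\<^sub>R p))"
    by (intro invertible_elt_mult)
  moreover have "(X *\<^sub>R 1 - b) * (1 - (X - norm b) *\<^sub>R p) = norm b *\<^sub>R 1 - b"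
    using p(1) by (simp add: right_diff_distrib scaleR_diff_left)
  moreover have "invertible_elt (norm b *\<^sub>R 1 + b)"
    using nonneg_invertible[OF b(1), of "norm b"] b(2) by (simp add: add.commute)
  ultimately show False
    using norm_attained_in_spectrum[of b] b nonneg_selfadjoint by auto
qed

end

section \<open>Hilbert modules containing a unit vector\<close>

context hilbert_module
begin

lemma act_zero_left [simp]: "act 0 x = 0"
  using act_add_left[of 0 0 x] by simp

lemma act_minus_left: "act (- a) x = - act a x"
  using act_add_left[of a "- a" x] by (simp add: eq_neg_iff_add_eq_0 add.commute)

lemma ip_add_left: "ip (x + y) z = ip x z + ip y z"
  using ip_linear[of 1 x 1 y z] by (simp add: act_one)

lemma ip_act_left: "ip (act a x) z = a * ip x z"
  using ip_linear[of a x 0 x z] by simp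

lemma ip_minus_left: "ip (- x) z = - ip x z"
  using ip_act_left[of "- 1" x z] by (simp add: act_minus_left act_one)

lemma ip_diff_left: "ip (x - y) z = ip x z - ip y z"
  using ip_add_left[of x "- y" z] by (simp add: ip_minus_left)

lemma ip_zero_left [simp]: "ip 0 z = 0"
  using ip_act_left[of 0 0 z] by simp

lemma ip_sum_left: "ip (\<Sum>i\<in>I. f i) z = (\<Sum>i\<in>I. ip (f i) z)"
  by (induction I rule: infinite_finite_induct) (auto simp: ip_add_left)

lemma ip_add_right: "ip z (x + y) = ip z x + ip z y"
  by (metis ip_commute ip_add_left star_add)

lemma ip_act_right: "ip z (act a x) = ip z x * star a"
  by (metis ip_commute ip_act_left star_mult)

lemma ip_diff_right: "ip z (x - y) = ip z x - ip z y"
  by (metis ip_commute ip_diff_left star_diff)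

lemma nonneg_ip: "nonneg (ip x x)"
  using ip_positive by (rule nonneg_of_cstar_positive)

lemma norm_ip_commute: "norm (ip x y) = norm (ip y x)"
  by (metis ip_commute norm_star)

lemma module_norm_power2: "(module_norm ip x)\<^sup>2 = norm (ip x x)"
  by (simp add: module_norm_def)

lemma module_norm_nonneg [simp]: "0 \<le> module_norm ip x"
  by (simp add: module_norm_def)

lemma module_norm_eq_0_iff: "module_norm ip x = 0 \<longleftrightarrow> x = 0"
  by (simp add: module_norm_def ip_eq_0_iff)

lemma module_norm_minus_commute: "module_norm ip (x - y) = module_norm ip (y - x)"
  by (simp add: module_norm_def ip_diff_left ip_diff_right algebra_simps)

lemma module_norm_scale: "module_norm ip (act (r *\<^sub>R 1) x) = \<bar>r\<bar> * module_norm ip x"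
  by (simp add: module_norm_def ip_act_left ip_act_right star_scaleR real_sqrt_mult
      flip: mult.assoc power2_eq_square)

lemma remove_component:
  fixes x v
  assumes "ip v v = 1"
  defines "x' \<equiv> x - act (ip x v) v"
  shows "ip x' v = 0"
    and "ip x x = ip x' x' + ip x v * star (ip x v)"
proof -
  show *: "ip x' v = 0" by (simp add: x'_def ip_diff_left ip_act_left assms)
  then have "ip v x' = 0" by (metis ip_commute star_zero)
  then have "ip x' x' = ip x x'" unfolding x'_def by (simp add: ip_diff_left ip_act_left)
  then show "ip x x = ip x' x' + ip x v * star (ip x v)"
    by (simp add: x'_def ip_diff_right ip_act_right)
qed

end

text \<open>
  A vector \<open>u\<close> with \<open>\<langle>u,u\<rangle> = 1\<close> gives \<open>a a\<^sup>* = \<langle>au,au\<rangle>\<close>, which is nonnegative by the axioms of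
  the inner product. This replaces the theorem of Fukamiya and Kaplansky that such
  products are positive in every C*-algebra.
\<close>
locale hilbert_module_unit_vector = hilbert_module cs star hs act ip
  for cs :: "complex \<Rightarrow> 'a \<Rightarrow> 'a::{real_normed_algebra, monoid_mult, banach}"
    and star hs and act :: "'a \<Rightarrow> 'h \<Rightarrow> 'h::ab_group_add" and ip +
  fixes u :: 'h
  assumes ip_unit: "ip u u = 1"
begin

lemma nonneg_mult_star: "nonneg (a * star a)"
  using nonneg_ip[of "act a u"] by (simp add: ip_act_left ip_act_right ip_unit)

text \<open>
  For \<open>Y\<close> beyond the norm of \<open>\<langle>y,y\<rangle>\<close> and \<open>c = \<langle>x,y\<rangle>\<close>, expand the square of
  \<open>z = x - Y\<^sup>-\<^sup>1c y\<close>. Writing \<open>Y - \<langle>y,y\<rangle> = s\<^sup>2\<close>, the difference \<open>\<langle>x,x\<rangle> - Y\<^sup>-\<^sup>1c c\<^sup>*\<close> is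
  \<open>\<langle>z,z\<rangle>\<close> plus a multiple of \<open>(c s)(c s)\<^sup>*\<close>, so it is nonnegative and the norm is monotone.
\<close>
lemma cauchy_schwarz: "(norm (ip x y))\<^sup>2 \<le> norm (ip x x) * norm (ip y y)"
proof -
  have le: "(norm (ip x y))\<^sup>2 \<le> Y * norm (ip x x)" if Y: "norm (ip y y) < Y" for Y
  proof -
    have Y0: "Y > 0" using Y norm_ge_zero[of "ip y y"] by linarith
    obtain s where s: "star s = s" "s * s = Y *\<^sub>R 1 - ip y y"
      by (rule selfadjoint_sqrt[OF nonneg_selfadjoint[OF nonneg_ip] Y]) (rule that)
    let ?c = "ip x y"
    let ?z = "x - act (inverse Y *\<^sub>R ?c) y"
    let ?w = "inverse Y *\<^sub>R (?c * s)"
    let ?v = "inverse (sqrt Y) *\<^sub>R ?c"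
    have yx: "ip y x = star ?c" by (rule ip_commute)
    have "?w * star ?w = (inverse Y * inverse Y) *\<^sub>R (?c * (s * s) * star ?c)"
      by (simp add: star_scaleR star_mult s(1) mult.assoc)
    also have "\<dots> = inverse Y *\<^sub>R (?c * star ?c) - (inverse Y * inverse Y) *\<^sub>R (?c * ip y y * star ?c)"
      using Y0 by (simp add: s(2) algebra_simps)
    finally have w: "?w * star ?w
        = inverse Y *\<^sub>R (?c * star ?c) - (inverse Y * inverse Y) *\<^sub>R (?c * ip y y * star ?c)" .
    have z: "ip ?z ?z = ip x x - inverse Y *\<^sub>R (?c * star ?c) - inverse Y *\<^sub>R (?c * star ?c)
        + (inverse Y * inverse Y) *\<^sub>R (?c * ip y y * star ?c)"
      by (simp add: ip_diff_left ip_diff_right ip_act_left ip_act_right star_scaleR yx algebra_simps)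
    have v: "?v * star ?v = inverse Y *\<^sub>R (?c * star ?c)"
      using Y0 by (simp add: star_scaleR flip: real_sqrt_mult inverse_mult_distrib)
    have "ip x x - ?v * star ?v = ip ?z ?z + ?w * star ?w"
      unfolding v w z by simp
    then have "nonneg (ip x x - ?v * star ?v)"
      using nonneg_add[OF nonneg_ip nonneg_mult_star] by metis
    then have "norm (?v * star ?v) \<le> norm (ip x x)"
      by (rule norm_mono[OF nonneg_mult_star])
    then show ?thesis
      unfolding v using Y0 by (simp add: norm_mult_star field_simps)
  qed
  show ?thesis
  proof (rule field_le_epsilon)
    fix \<epsilon> :: real assume "\<epsilon> > 0"
    let ?\<delta> = "\<epsilon> / (norm (ip x x) + 1)"
    have n: "norm (ip x x) + 1 > 0" using norm_ge_zero[of "ip x x"] by linarith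
    have "?\<delta> > 0" using \<open>\<epsilon> > 0\<close> n by simp
    then have "(norm (ip x y))\<^sup>2 \<le> (norm (ip y y) + ?\<delta>) * norm (ip x x)"
      by (intro le) simp
    moreover have "?\<delta> * norm (ip x x) \<le> \<epsilon>"
      using \<open>\<epsilon> > 0\<close> n by (simp add: field_simps)
    ultimately show "(norm (ip x y))\<^sup>2 \<le> norm (ip x x) * norm (ip y y) + \<epsilon>"
      by (simp add: algebra_simps)
  qed
qed

lemma norm_ip_le: "norm (ip x y) \<le> module_norm ip x * module_norm ip y"
proof (rule power2_le_imp_le)
  show "(norm (ip x y))\<^sup>2 \<le> (module_norm ip x * module_norm ip y)\<^sup>2"
    unfolding power_mult_distrib module_norm_power2 by (rule cauchy_schwarz)
  show "0 \<le> module_norm ip x * module_norm ip y"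
    by (intro mult_nonneg_nonneg module_norm_nonneg)
qed

lemma module_norm_triangle: "module_norm ip (x + y) \<le> module_norm ip x + module_norm ip y"
proof (rule power2_le_imp_le)
  have "(module_norm ip (x + y))\<^sup>2 = norm ((ip x x + ip x y) + (ip y x + ip y y))"
    by (simp add: module_norm_power2 ip_add_left ip_add_right algebra_simps)
  also have "\<dots> \<le> (norm (ip x x) + norm (ip x y)) + (norm (ip y x) + norm (ip y y))"
    by (intro norm_triangle_mono order_refl)
  also have "\<dots> \<le> (module_norm ip x + module_norm ip y)\<^sup>2"
    using norm_ip_le[of x y] norm_ip_le[of y x]
    by (simp add: power2_sum algebra_simps flip: module_norm_power2)
  finally show "(module_norm ip (x + y))\<^sup>2 \<le> (module_norm ip x + module_norm ip y)\<^sup>2" .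
qed simp

lemma Metric_space_module_norm: "Metric_space UNIV (\<lambda>x y. module_norm ip (x - y))"
proof (rule Metric_space.intro)
  show "0 \<le> module_norm ip (x - y)" for x y
    by (rule module_norm_nonneg)
  show "module_norm ip (x - y) = module_norm ip (y - x)" for x y
    by (rule module_norm_minus_commute)
  show "module_norm ip (x - y) = 0 \<longleftrightarrow> x = y" for x y
    unfolding module_norm_eq_0_iff by (rule right_minus_eq)
  show "module_norm ip (x - z) \<le> module_norm ip (x - y) + module_norm ip (y - z)" for x y z
    using module_norm_triangle[of "x - y" "y - z"] by simp
qed

section \<open>The lower frame bound of a finite generating family\<close>

text \<open>
  A uniform boundedness argument. Write \<open>N y\<close> for the sum of the norms of the \<open>\<langle>y,e\<^sub>n\<rangle>\<close>.
  Expanding \<open>x\<close> in the generators bounds \<open>\<langle>x,y\<rangle>\<close> by a multiple of \<open>N y\<close> that depends on \<open>x\<close>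
  only. The sets on which one multiple works are closed and cover the module, so by Baire's theorem
  one of them contains a ball; translating the ball to the origin gives a multiple that works
  for all small \<open>x\<close>, in particular for a rescaled \<open>y\<close>.
\<close>
lemma frame_lower_bound:
  assumes gen: "alg_generates act e k"
  obtains C where "C \<ge> 0" "\<And>y. module_norm ip y \<le> C * (\<Sum>n\<le>k. norm (ip y (e n)))"
proof -
  interpret Metric_space UNIV "\<lambda>x y. module_norm ip (x - y)"
    by (rule Metric_space_module_norm)
  let ?N = "\<lambda>y. \<Sum>n\<le>k. norm (ip y (e n))"
  define F where "F m = {x. \<forall>y. norm (ip x y) \<le> real m * ?N y}" for m :: nat
  have N0: "?N y \<ge> 0" for y by (rule sum_nonneg) simp
  have "x \<in> (\<Union>m. F m)" for x
  proof -
    obtain c where x: "x = (\<Sum>n\<le>k. act (c n) (e n))"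
      using gen unfolding alg_generates_def by blast
    define B where "B = (\<Sum>n\<le>k. norm (c n))"
    have "norm (ip x y) \<le> real (nat \<lceil>B\<rceil>) * ?N y" for y
    proof -
      have "norm (ip x y) \<le> (\<Sum>n\<le>k. norm (c n * ip (e n) y))"
        unfolding x ip_sum_left ip_act_left by (rule norm_sum)
      also have "\<dots> \<le> (\<Sum>n\<le>k. B * norm (ip y (e n)))"
      proof (rule sum_mono)
        fix n assume n: "n \<in> {..k}"
        have "norm (c n * ip (e n) y) \<le> norm (c n) * norm (ip y (e n))"
          using norm_mult_ineq norm_ip_commute by metis
        also have "norm (c n) \<le> B"
          unfolding B_def using n by (intro member_le_sum) auto
        finally show "norm (c n * ip (e n) y) \<le> B * norm (ip y (e n))"
          by (simp add: mult_right_mono)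
      qed
      also have "\<dots> = B * ?N y" by (simp add: sum_distrib_left)
      also have "\<dots> \<le> real (nat \<lceil>B\<rceil>) * ?N y"
        using N0 by (intro mult_right_mono) (auto simp: real_nat_ceiling_ge)
      finally show ?thesis .
    qed
    then show ?thesis unfolding F_def by blast
  qed
  then have cover: "\<Union>(range F) = UNIV" by blast
  have closed: "closedin mtopology (F m)" for m
    unfolding closedin_metric
  proof (intro conjI allI impI)
    fix x assume "x \<in> UNIV - F m"
    then have "\<exists>y. \<not> norm (ip x y) \<le> real m * ?N y" unfolding F_def by simp
    then obtain y where y: "norm (ip x y) > real m * ?N y" by (meson not_le)
    define r where "r = (norm (ip x y) - real m * ?N y) / (module_norm ip y + 1)"
    have y1: "module_norm ip y + 1 > 0" using module_norm_nonneg[of y] by linarith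
    have r: "r > 0" using y y1 by (simp add: r_def)
    have "x' \<notin> F m" if "module_norm ip (x - x') < r" for x'
    proof -
      have "norm (ip x y) \<le> norm (ip x' y) + norm (ip (x - x') y)"
        using norm_triangle_ineq[of "ip x' y" "ip (x - x') y"] by (simp add: ip_diff_left)
      also have "norm (ip (x - x') y) \<le> module_norm ip (x - x') * module_norm ip y"
        by (rule norm_ip_le)
      also have "\<dots> \<le> r * module_norm ip y"
        using that by (intro mult_right_mono) auto
      also have "\<dots> < r * (module_norm ip y + 1)" using r by simp
      also have "\<dots> = norm (ip x y) - real m * ?N y" using y1 by (simp add: r_def)
      finally have "norm (ip x' y) > real m * ?N y" by simp
      then show ?thesis unfolding F_def by (auto simp: not_le intro!: exI[of _ y])
    qed
    then show "\<exists>r>0. disjnt (F m) (mball x r)"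
      using r by (intro exI[of _ r]) (auto simp: disjnt_iff)
  qed simp
  have "\<exists>m. mtopology interior_of (F m) \<noteq> {}"
  proof (rule ccontr)
    assume "\<not> ?thesis"
    then have "mtopology interior_of \<Union>(range F) = {}"
      using closed complete by (intro metric_Baire_category_alt) auto
    then show False using cover interior_of_topspace[of mtopology] by simp
  qed
  then obtain m x where "x \<in> mtopology interior_of (F m)" by blast
  moreover have "openin mtopology (mtopology interior_of (F m))" by simp
  ultimately obtain r where "r > 0" "mball x r \<subseteq> mtopology interior_of (F m)"
    unfolding openin_mtopology by blast
  then have r: "r > 0" "mball x r \<subseteq> F m"
    using interior_of_subset[of mtopology "F m"] by auto
  have ball: "norm (ip h y) \<le> 2 * real m * ?N y" if h: "module_norm ip h < r" for h y
  proof -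
    have "module_norm ip (x - (x + h)) = module_norm ip h"
      using module_norm_minus_commute[of x "x + h"] by simp
    then have "x + h \<in> mball x r" "x \<in> mball x r"
      using r(1) h module_norm_eq_0_iff[of 0] by simp_all
    then have "x + h \<in> F m" "x \<in> F m" using r(2) by blast+
    then have "norm (ip (x + h) y) \<le> real m * ?N y" "norm (ip x y) \<le> real m * ?N y"
      unfolding F_def by blast+
    moreover have "norm (ip h y) \<le> norm (ip (x + h) y) + norm (ip x y)"
      using norm_triangle_ineq4[of "ip (x + h) y" "ip x y"] by (simp add: ip_add_left)
    ultimately show ?thesis by linarith
  qed
  show thesis
  proof
    show "4 * real m / r \<ge> 0" using r by simp
    fix y
    show "module_norm ip y \<le> 4 * real m / r * ?N y"
    proof (cases "y = 0")
      case True
      then show ?thesis by (simp add: module_norm_def)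
    next
      case False
      let ?M = "module_norm ip y"
      have M: "?M > 0"
        using False module_norm_eq_0_iff[of y] module_norm_nonneg[of y] by linarith
      define t where "t = r / (2 * ?M)"
      have t: "t > 0" using r M by (simp add: t_def)
      have "module_norm ip (act (t *\<^sub>R 1) y) < r"
        using t M r by (simp add: module_norm_scale t_def)
      from ball[OF this, of y] have "t * ?M\<^sup>2 \<le> 2 * real m * ?N y"
        using t by (simp add: ip_act_left module_norm_power2)
      moreover have "t * ?M\<^sup>2 = r * ?M / 2" using M by (simp add: t_def power2_eq_square)
      ultimately show ?thesis using r by (simp add: field_simps)
    qed
  qed
qed

section \<open>Contraction over one period\<close>

text \<open>
  Let \<open>x\<close> be the residual before the sweep, \<open>y\<close> the one after it, \<open>b = \<langle>y,y\<rangle>\<close>, and let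
  \<open>a\<^sub>i\<close> be the coefficients removed, so that \<open>\<langle>x,x\<rangle> = b + \<Sum> a\<^sub>i a\<^sub>i\<^sup>*\<close>. In a Hilbert
  space one would compare numbers: small \<open>a\<^sub>i\<close> force all \<open>\<langle>y,e\<^sub>n\<rangle>\<close> to be small, hence \<open>y\<close>. In
  an algebra the \<open>a\<^sub>i\<close> may be large where \<open>b\<close> is far from its norm, and everything has to be
  localised where \<open>b\<close> is large. The resolvent \<open>p = (X - b)\<^sup>-\<^sup>1\<close>, with \<open>X\<close> slightly above
  the norm of \<open>\<langle>x,x\<rangle>\<close>, does this. Since \<open>\<Sum> a\<^sub>i a\<^sub>i\<^sup>* \<le> X - b\<close>, one has
  \<open>(p a\<^sub>i)(p a\<^sub>i)\<^sup>* \<le> p (X - b) p = p\<close>, so the norm of \<open>p a\<^sub>i\<close> is at most the root of that of \<open>p\<close>.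
  The coefficients \<open>\<langle>py,e\<^sub>n\<rangle>\<close> are combinations of the \<open>p a\<^sub>i\<close>, so the frame bound gives
  \<open>norm (p b p) \<le> K norm p\<close>. But \<open>p b p = X p\<^sup>2 - p\<close>, and therefore
  \<open>X norm p \<le> 1 + K\<close>. As \<open>norm p\<close> is at least \<open>1 / (X - norm b)\<close>, this separates \<open>norm b\<close> from
  \<open>X\<close> by the fixed proportion \<open>1 / (1 + K)\<close>.
\<close>
lemma sweep_contraction:
  assumes unit: "\<And>n. n \<le> k \<Longrightarrow> ip (e n) (e n) = 1"
    and C: "C \<ge> 0" "\<And>y. module_norm ip y \<le> C * (\<Sum>n\<le>k. norm (ip y (e n)))"
    and step: "\<And>i. i \<le> k \<Longrightarrow> r (Suc i) = r i - act (ip (r i) (e i)) (e i)"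
  defines "K \<equiv> (C * (real (Suc k))\<^sup>2)\<^sup>2"
  shows "norm (ip (r (Suc k)) (r (Suc k))) \<le> K / (1 + K) * norm (ip (r 0) (r 0))"
proof -
  define a where "a i = ip (r i) (e i)" for i
  have K: "K \<ge> 0" by (simp add: K_def)
  have pyth: "ip (r 0) (r 0) = ip (r m) (r m) + (\<Sum>i<m. a i * star (a i))" if "m \<le> Suc k" for m
    using that
  proof (induction m)
    case (Suc m)
    then show ?case
      using remove_component(2)[OF unit, of m "r m"] step[of m]
      by (simp add: a_def add_ac)
  qed simp
  \<comment> \<open>Step \<open>n\<close> makes the residual orthogonal to \<open>e n\<close>; only the later steps destroy this.\<close>
  have coeff: "ip (r m) (e n) = - (\<Sum>i\<in>{Suc n..<m}. a i * ip (e i) (e n))"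
    if "Suc n \<le> m" "m \<le> Suc k" for m n
    using that
  proof (induction m rule: dec_induct)
    case base
    then show ?case using remove_component(1)[OF unit, of n "r n"] step[of n] by simp
  next
    case (step m)
    then show ?case
      using assms(4)[of m] by (simp add: ip_diff_left ip_act_left a_def)
  qed
  define y where "y = r (Suc k)"
  define b where "b = ip y y"
  have pyth': "ip (r 0) (r 0) = b + (\<Sum>i\<le>k. a i * star (a i))"
    using pyth[of "Suc k"] by (simp add: b_def y_def lessThan_Suc_atMost)
  have b0: "nonneg b" by (simp add: b_def nonneg_ip)
  have nb: "norm b \<le> norm (ip (r 0) (r 0))"
    using b0 by (rule norm_mono) (simp add: pyth' nonneg_sum nonneg_mult_star)
  have main: "norm b \<le> K / (1 + K) * X" if X: "norm (ip (r 0) (r 0)) < X" for X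
  proof (cases "b = 0")
    case True
    have "X \<ge> 0" using X norm_ge_zero[of "ip (r 0) (r 0)"] by linarith
    with True K show ?thesis by simp
  next
    case False
    have bX: "norm b < X" using nb X by linarith
    then obtain p where p: "(X *\<^sub>R 1 - b) * p = 1" "p * (X *\<^sub>R 1 - b) = 1"
      using invertible_scalar_minus[OF bX] unfolding invertible_elt_def by blast
    have "p \<noteq> 0" using p(1) False by (metis mult_zero_right mult.right_neutral)
    then have p0: "norm p > 0" by simp
    have sp: "star p = p"
      by (rule star_inverse[OF _ p]) (simp add: star_diff star_scaleR nonneg_selfadjoint[OF b0])
    obtain s where s: "star s = s" "s * s = X *\<^sub>R 1 - ip (r 0) (r 0)"
      by (rule selfadjoint_sqrt[OF nonneg_selfadjoint[OF nonneg_ip] X]) (rule that)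
    \<comment> \<open>Multiply by \<open>p\<close> on both sides: \<open>p\<close> becomes a sum of terms \<open>z z\<^sup>*\<close>, each
      \<open>(p a\<^sub>j)(p a\<^sub>j)\<^sup>*\<close> among them.\<close>
    have "X *\<^sub>R 1 - b = s * s + (\<Sum>i\<le>k. a i * star (a i))"
      by (simp add: s(2) pyth')
    then have "p * (X *\<^sub>R 1 - b) * p = p * (s * s + (\<Sum>i\<le>k. a i * star (a i))) * p" by simp
    then have "p = (p * s) * star (p * s) + (\<Sum>i\<le>k. (p * a i) * star (p * a i))"
      by (simp add: p sp s(1) star_mult distrib_left distrib_right sum_distrib_left
          sum_distrib_right mult.assoc)
    note p_eq = this
    have split: "p - (p * a j) * star (p * a j)
        = (p * s) * star (p * s) + (\<Sum>i\<in>{..k} - {j}. (p * a i) * star (p * a i))"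
      if "j \<le> k" for j
    proof -
      have diff: "x - v = w + z" if "x = w + y" "y = v + z" for v w x y z :: 'a
        using that by simp
      show ?thesis
        by (rule diff[OF p_eq]) (rule sum.remove, use that in simp_all)
    qed
    have pa: "norm (p * a j) \<le> sqrt (norm p)" if "j \<le> k" for j
    proof -
      have "nonneg (p - (p * a j) * star (p * a j))"
        unfolding split[OF that] by (intro nonneg_add nonneg_sum nonneg_mult_star)
      from norm_mono[OF nonneg_mult_star this] show ?thesis
        by (simp add: norm_mult_star real_le_rsqrt)
    qed
    have pe: "norm (ip (act p y) (e n)) \<le> real (Suc k) * sqrt (norm p)" if n: "n \<le> k" for n
    proof -
      have "ip (act p y) (e n) = - (\<Sum>i\<in>{Suc n..<Suc k}. (p * a i) * ip (e i) (e n))"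
        using n coeff[of n "Suc k"]
        by (simp add: ip_act_left y_def sum_distrib_left mult.assoc del: sum.op_ivl_Suc)
      then have "norm (ip (act p y) (e n)) = norm (\<Sum>i\<in>{Suc n..<Suc k}. (p * a i) * ip (e i) (e n))"
        by simp
      also have "\<dots> \<le> (\<Sum>i\<in>{Suc n..<Suc k}. sqrt (norm p))"
      proof (rule sum_norm_le)
        fix i assume i: "i \<in> {Suc n..<Suc k}"
        have "norm (ip (e i) (e n)) \<le> sqrt (norm (1::'a)) * sqrt (norm (1::'a))"
          using norm_ip_le[of "e i" "e n"] unit i n by (simp add: module_norm_def)
        also have "\<dots> \<le> 1" using norm_one_le by simp
        finally have "norm (p * a i) * norm (ip (e i) (e n)) \<le> sqrt (norm p) * 1"
          using pa i by (intro mult_mono) auto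
        then show "norm ((p * a i) * ip (e i) (e n)) \<le> sqrt (norm p)"
          using norm_mult_ineq[of "p * a i" "ip (e i) (e n)"] by linarith
      qed
      also have "\<dots> \<le> real (Suc k) * sqrt (norm p)"
        by (simp add: mult_right_mono)
      finally show ?thesis .
    qed
    have "module_norm ip (act p y) \<le> C * (\<Sum>n\<le>k. norm (ip (act p y) (e n)))"
      by (rule C)
    also have "\<dots> \<le> C * (\<Sum>n\<le>k. real (Suc k) * sqrt (norm p))"
      using C(1) pe by (intro mult_left_mono sum_mono) auto
    also have "\<dots> = C * (real (Suc k))\<^sup>2 * sqrt (norm p)"
      by (simp add: power2_eq_square mult_ac)
    finally have "(module_norm ip (act p y))\<^sup>2 \<le> (C * (real (Suc k))\<^sup>2 * sqrt (norm p))\<^sup>2"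
      by (intro power_mono) auto
    then have pbp: "norm (p * b * p) \<le> K * norm p"
      by (simp add: module_norm_power2 ip_act_left ip_act_right sp b_def K_def
          power_mult_distrib mult.assoc)
    have "p * (X *\<^sub>R 1 - b) * p = X *\<^sub>R (p * p) - p * b * p"
      by (simp add: algebra_simps)
    then have "X *\<^sub>R (p * p) - p * b * p = p" by (simp only: p(2) mult_1_left)
    then have "X *\<^sub>R (p * p) = p + p * b * p" by (simp only: diff_eq_eq)
    then have "\<bar>X\<bar> * (norm p)\<^sup>2 \<le> norm p + norm (p * b * p)"
      using norm_triangle_ineq[of p "p * b * p"]
      by (metis norm_scaleR norm_square_selfadjoint[OF sp])
    then have "(X * norm p) * norm p \<le> (1 + K) * norm p"
      using pbp bX norm_ge_zero[of b] by (simp add: power2_eq_square algebra_simps)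
    then have Xp: "X * norm p \<le> 1 + K" using p0 by simp
    have X0: "X > 0" using bX norm_ge_zero[of b] by linarith
    have "1 \<le> (X - norm b) * norm p"
      using resolvent_norm_ge[OF b0 False p] bX by simp
    then have "X * 1 \<le> X * ((X - norm b) * norm p)"
      using X0 by (intro mult_left_mono) auto
    also have "\<dots> = (X - norm b) * (X * norm p)" by simp
    also have "\<dots> \<le> (X - norm b) * (1 + K)"
      using Xp bX by (intro mult_left_mono) auto
    finally show ?thesis using K by (simp add: field_simps)
  qed
  have "norm b \<le> K / (1 + K) * norm (ip (r 0) (r 0))"
  proof (rule field_le_epsilon)
    fix \<epsilon> :: real assume \<epsilon>: "\<epsilon> > 0"
    have "norm b \<le> K / (1 + K) * (norm (ip (r 0) (r 0)) + \<epsilon>)"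
      using \<epsilon> by (intro main) simp
    also have "\<dots> \<le> K / (1 + K) * norm (ip (r 0) (r 0)) + \<epsilon>"
      using K \<epsilon> by (simp add: field_simps)
    finally show "norm b \<le> K / (1 + K) * norm (ip (r 0) (r 0)) + \<epsilon>" .
  qed
  then show ?thesis by (simp add: b_def y_def)
qed

end

section \<open>Effectiveness\<close>
lemma tendsto_zero_of_periodic_contraction:
  fixes g :: "nat \<Rightarrow> real"
  assumes nonneg: "\<And>n. g n \<ge> 0" and dec: "decseq g"
    and q: "0 \<le> q" "q < 1" and contr: "\<And>m. g (Suc m * p) \<le> q * g (m * p)"
  shows "g \<longlonglongrightarrow> 0"
proof (rule LIMSEQ_I)
  fix \<epsilon> :: real assume "\<epsilon> > 0"
  have geo: "g (m * p) \<le> q ^ m * g 0" for m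
  proof (induction m)
    case (Suc m)
    show ?case
      using contr[of m] mult_left_mono[OF Suc q(1)] by simp
  qed simp
  have "(\<lambda>m. q ^ m * g 0) \<longlonglongrightarrow> 0"
    using q by (intro tendsto_mult_left_zero LIMSEQ_power_zero) simp
  then obtain m where m: "q ^ m * g 0 < \<epsilon>"
    using order_tendstoD(2)[OF _ \<open>\<epsilon> > 0\<close>] by (metis (no_types, lifting) eventually_sequentially order_refl)
  have "norm (g n - 0) < \<epsilon>" if "n \<ge> m * p" for n
    using decseqD[OF dec that] geo[of m] m nonneg[of n] by simp
  then show "\<exists>N. \<forall>n\<ge>N. norm (g n - 0) < \<epsilon>" by blast
qed

theorem theorem3p9:
  fixes cs :: "complex \<Rightarrow> 'a \<Rightarrow> 'a::{real_normed_algebra, monoid_mult, banach}"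
    and star :: "'a \<Rightarrow> 'a"
    and hs :: "complex \<Rightarrow> 'h \<Rightarrow> 'h::ab_group_add"
    and act :: "'a \<Rightarrow> 'h \<Rightarrow> 'h"
    and ip :: "'h \<Rightarrow> 'h \<Rightarrow> 'a"
    and e :: "nat \<Rightarrow> 'h"
    and k :: nat
  assumes "hilbert_module cs star hs act ip"
    and "alg_generates act e k"
    and "\<And>n. n \<le> k \<Longrightarrow> ip (e n) (e n) = 1"
    and "\<And>n. e (n + k + 1) = e n"
  shows "effective act ip e"
proof -
  interpret hilbert_module cs star hs act ip by fact
  interpret hilbert_module_unit_vector cs star hs act ip "e 0"
    by unfold_locales (simp add: assms)
  have per: "e (m * Suc k + i) = e i" for m i
  proof (induction m)
    case (Suc m)
    then show ?case using assms(4)[of "m * Suc k + i"] by (simp add: algebra_simps)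
  qed simp
  have unit: "ip (e n) (e n) = 1" for n
  proof -
    have "e n = e (n mod Suc k)"
      using per[of "n div Suc k" "n mod Suc k"] by (simp only: div_mult_mod_eq)
    then show ?thesis using assms(3)[of "n mod Suc k"] by (simp add: less_Suc_eq_le[symmetric])
  qed
  obtain C where C: "C \<ge> 0" "\<And>y. module_norm ip y \<le> C * (\<Sum>n\<le>k. norm (ip y (e n)))"
    using frame_lower_bound[OF assms(2)] by blast
  define K where "K = (C * (real (Suc k))\<^sup>2)\<^sup>2"
  have K: "K \<ge> 0" by (simp add: K_def)
  have "(\<lambda>n. module_norm ip (kaczmarz act ip e x n - x)) \<longlonglongrightarrow> 0" for x
  proof -
    \<comment> \<open>The residuals with \<open>x\<close> put in front: then step \<open>n\<close> of the iteration uses \<open>e n\<close>, also for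
      \<open>n = 0\<close>, and the sweeps begin at the multiples of the period.\<close>
    define r where "r n = (case n of 0 \<Rightarrow> x | Suc m \<Rightarrow> x - kaczmarz act ip e x m)" for n
    have step: "r (Suc n) = r n - act (ip (r n) (e n)) (e n)" for n
      by (cases n) (simp_all add: r_def algebra_simps)
    let ?g = "\<lambda>n. norm (ip (r n) (r n))"
    have "?g (Suc n) \<le> ?g n" for n
      using remove_component(2)[OF unit, of "r n" n] step[of n]
      by (intro norm_mono nonneg_ip) (simp add: nonneg_mult_star)
    then have "decseq ?g" by (rule decseq_SucI)
    moreover have "?g (Suc m * Suc k) \<le> K / (1 + K) * ?g (m * Suc k)" for m
    proof -
      have "r (m * Suc k + Suc i) = r (m * Suc k + i) - act (ip (r (m * Suc k + i)) (e i)) (e i)" for i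
        using step[of "m * Suc k + i"] by (simp only: per add_Suc_right)
      then have "?g (m * Suc k + Suc k) \<le> K / (1 + K) * ?g (m * Suc k + 0)"
        unfolding K_def by (intro sweep_contraction[OF unit C, of "\<lambda>i. r (m * Suc k + i)"])
      then show ?thesis by (simp only: mult_Suc add.commute add_0_right add_0_left)
    qed
    ultimately have "?g \<longlonglongrightarrow> 0"
      using K by (intro tendsto_zero_of_periodic_contraction[of ?g "K / (1 + K)" "Suc k"]) auto
    then have "(\<lambda>n. ?g (Suc n)) \<longlonglongrightarrow> 0" by (rule LIMSEQ_Suc)
    then have "(\<lambda>n. sqrt (?g (Suc n))) \<longlonglongrightarrow> 0" using tendsto_real_sqrt by fastforce
    then have "(\<lambda>n. module_norm ip (x - kaczmarz act ip e x n)) \<longlonglongrightarrow> 0"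
      by (simp add: r_def module_norm_def)
    then show ?thesis by (simp only: module_norm_minus_commute)
  qed
  then show ?thesis unfolding effective_def using unit by blast
qed

end
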